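(* Let $p>0$ satisfy $2/p\in\mathbb{N}$, let $\varphi\in[0,2\pi)$, let $\omega\geq 0$ and let $0<\gamma<1$. Put $\eta:=(1-\tfrac{1}{p})\omega+\tfrac{2-\gamma}{p}-1$. Then for every $r>0$, $$\bigl(D_{0+;p,\eta}^{\gamma}\mathcal{J}_{\omega+\gamma,\varphi}^{[p]}\bigr)(r)=\Bigl(\frac{r}{p}\Bigr)^{\gamma}\mathcal{J}_{\omega,\varphi}^{[p]}(r).$$
   Context: For $p>0$ with $2/p\in\mathbb{N}$, real order $\omega\geq0$ and angle $\varphi\in[0,2\pi)$, the $p$-Bessel function is defined for $r\ge 0$ by $$\mathcal{J}_{\omega,\varphi}^{[p]}(r)=\Bigl(\frac{2}{p}\Bigr)^{2+\omega}\frac{\pi}{\Gamma(\frac1p)^2}\sum_{k=0}^{\infty}\frac{(-1)^k}{k!\,\Gamma(\frac2p(k+1)+\omega)}\Bigl(\frac r2\Bigr)^{2k+\omega}\Phi_{k,\varphi}^{[p]},$$ $$\Phi_{k,\varphi}^{[p]}=\sum_{n=0}^{k}\frac{(\frac2p(k+1)-1)!}{n!\,(k-n)!}\,\frac{B(\frac2p(n+\frac12),\frac2p(k-n+\frac12))}{B(n+\frac12,k-n+\frac12)}\,(\cos^{4/p}\varphi)^n(\sin^{4/p}\varphi)^{k-n},$$ where $B$ is the Beta function. For a function $f$ on $(0,\infty)$, $p>0$, $\eta\in\mathbb{R}$ and $\gamma>0$, the Erdélyi–Kober-type fractional integral is $$(I_{0+;p,\eta}^{\gamma}f)(r)=\frac{p}{\Gamma(\gamma)}\int_0^1\frac{\tau^{p(\eta+1)-1}f(\tau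 r)}{(1-\tau^p)^{1-\gamma}}\,d\tau,$$ and for $0<\gamma<1$ the Erdélyi–Kober-type fractional derivative is $$(D_{0+;p,\eta}^{\gamma}f)(r)=r^{-p\eta}\Bigl(\frac{1}{p\,r^{p-1}}\frac{d}{dr}\Bigr)\Bigl(r^{p(1+\eta)}(I_{0+;p,\eta+\gamma}^{1-\gamma}f)(r)\Bigr),\qquad r>0.$$ *)

theory Defs
  imports "HOL-Analysis.Analysis"
begin

text \<open>
  The definitions below are meant for \<open>p > 0\<close> with \<open>2 / p \<in> \<nat>\<close>. Then \<open>nat \<lfloor>2 / p\<rfloor>\<close> is exactly
  the natural number \<open>2 / p\<close>. The exponent \<open>4 / p\<close> of sine and cosine is a natural power because
  \<open>powr\<close> is not the intended power for nonpositive bases.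
\<close>

definition p_Bessel_Phi :: "real \<Rightarrow> nat \<Rightarrow> real \<Rightarrow> real" where
  "p_Bessel_Phi p k \<phi> =
     (\<Sum>n=0..k.
        fact (nat \<lfloor>2 / p\<rfloor> * (k + 1) - 1) / (fact n * fact (k - n))
        * (Beta (2 / p * (real n + 1 / 2)) (2 / p * (real (k - n) + 1 / 2))
           / Beta (real n + 1 / 2) (real (k - n) + 1 / 2))
        * (cos \<phi> ^ (2 * nat \<lfloor>2 / p\<rfloor>)) ^ n * (sin \<phi> ^ (2 * nat \<lfloor>2 / p\<rfloor>)) ^ (k - n))"

text \<open>
  The case distinction only matters at \<open>r = 0\<close>: the intended value of \<open>0\<^sup>0\<close> is 1, while
  \<open>0 powr 0 = 0\<close>.
\<close>

definition p_Bessel :: "real \<Rightarrow> real \<Rightarrow> real \<Rightarrow> real \<Rightarrow> real" where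
  "p_Bessel p \<omega> \<phi> r =
     (2 / p) powr (2 + \<omega>) * (pi / (Gamma (1 / p))\<^sup>2) *
     (\<Sum>k. (-1) ^ k / (fact k * Gamma (2 / p * (real k + 1) + \<omega>))
           * (if 2 * real k + \<omega> = 0 then 1 else (r / 2) powr (2 * real k + \<omega>))
           * p_Bessel_Phi p k \<phi>)"

definition EK_integrand ::
    "real \<Rightarrow> real \<Rightarrow> real \<Rightarrow> (real \<Rightarrow> real) \<Rightarrow> real \<Rightarrow> real \<Rightarrow> real" where
  "EK_integrand p \<eta> \<gamma> f r \<tau> =
     \<tau> powr (p * (\<eta> + 1) - 1) * f (\<tau> * r) / (1 - \<tau> powr p) powr (1 - \<gamma>)"

definition EK_integral ::
    "real \<Rightarrow> real \<Rightarrow> real \<Rightarrow> (real \<Rightarrow> real) \<Rightarrow> real \<Rightarrow> real" where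
  "EK_integral p \<eta> \<gamma> f r =
     p / Gamma \<gamma> * (LBINT \<tau>:{0<..<1}. EK_integrand p \<eta> \<gamma> f r \<tau>)"

definition EK_deriv ::
    "real \<Rightarrow> real \<Rightarrow> real \<Rightarrow> (real \<Rightarrow> real) \<Rightarrow> real \<Rightarrow> real" where
  "EK_deriv p \<eta> \<gamma> f r =
     r powr (- p * \<eta>) * (1 / (p * r powr (p - 1))
       * deriv (\<lambda>s. s powr (p * (1 + \<eta>)) * EK_integral p (\<eta> + \<gamma>) (1 - \<gamma>) f s) r)"

text \<open>
  Integrals and \<open>deriv\<close> are total in HOL. The next predicate says that the integral and the
  derivative occurring in \<open>EK_deriv p \<eta> \<gamma> f r\<close> really exist.
\<close>

definition EK_deriv_exists ::
    "real \<Rightarrow> real \<Rightarrow> real \<Rightarrow> (real \<Rightarrow> real) \<Rightarrow> real \<Rightarrow> bool" where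
  "EK_deriv_exists p \<eta> \<gamma> f r \<longleftrightarrow>
     (\<forall>s>0. set_integrable lborel {0<..<1} (EK_integrand p (\<eta> + \<gamma>) (1 - \<gamma>) f s)) \<and>
     (\<lambda>s. s powr (p * (1 + \<eta>)) * EK_integral p (\<eta> + \<gamma>) (1 - \<gamma>) f s)
       field_differentiable (at r)"

end

theory Submission
  imports Defs
begin

text \<open>
  Put \<open>A k = 2 / p * (k + 1) + \<omega>\<close>. Termwise, the substitution \<open>u = \<tau> powr p\<close> turns the fractional
  integral of the power series into Beta integrals. It multiplies the \<open>k\<close>-th coefficient by
  \<open>Gamma (A k + \<gamma>) / Gamma (A k + 1)\<close>, and the numerator cancels the Gamma function in the
  series of order \<open>\<omega> + \<gamma>\<close>. By the choice of \<open>\<eta>\<close>, the factor in front of the fractional integral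
  makes the \<open>k\<close>-th power \<open>s powr (p * A k)\<close>, and the derivative brings down \<open>p * A k\<close>, which
  turns \<open>Gamma (A k + 1)\<close> into \<open>Gamma (A k)\<close>. The interchange with integral and derivative is
  justified by \<open>\<bar>Phi k\<bar> \<le> 4 * 2 ^ k * Gamma (2 / p * (k + 1))\<close>: since \<open>2 / p \<ge> 1\<close>, the Beta
  function in the numerator of \<open>Phi\<close> is at most \<open>Beta (1 / 2) (1 / 2) = pi\<close>, and the one in the
  denominator contributes only a factorial, so all the power series are entire.
\<close>

section \<open>Growth of the coefficients \<open>p_Bessel_Phi\<close>\<close>

text \<open>\<open>Gamma (n + 1 / 2) / sqrt pi\<close> is the product of the numbers
  \<open>1 / 2 + i\<close> for \<open>i < n\<close>. Only the factor with \<open>i = 0\<close> is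
  below 1, which gives the uniform constant \<open>1 / 2\<close>, attained at
  \<open>n = 1\<close>.\<close>

lemma Gamma_half_ge: "Gamma (real n + 1 / 2) \<ge> sqrt pi / 2"
proof -
  have "pochhammer (1 / 2 :: real) n \<ge> 1 / 2"
  proof (induction n)
    case (Suc n)
    show ?case
    proof (cases n)
      case (Suc m)
      have "1 / 2 * 1 \<le> pochhammer (1 / 2 :: real) n * (1 / 2 + real n)"
        using Suc.IH Suc by (intro mult_mono) auto
      then show ?thesis
        by (simp add: pochhammer_Suc)
    qed auto
  qed auto
  moreover have "pochhammer (1 / 2 :: real) n = Gamma (1 / 2 + real n) / sqrt pi"
    by (subst pochhammer_Gamma) (auto simp: Gamma_one_half_real)
  ultimately show ?thesis
    by (simp add: field_simps add.commute)
qed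

text \<open>For \<open>\<omega> > 0\<close> the quotient is
  \<open>Beta x \<omega> / Gamma \<omega>\<close>, and Beta decreases in its first argument; the
  bound is its value at \<open>x = 1\<close>. The case \<open>\<omega> = 0\<close> is separate
  because Beta has a pole there.\<close>

lemma Gamma_ratio_le:
  fixes x \<omega> :: real
  assumes "x \<ge> 1" and "\<omega> \<ge> 0"
  shows "Gamma x / Gamma (x + \<omega>) \<le> 1 / Gamma (1 + \<omega>)"
proof (cases "\<omega> = 0")
  case True
  then show ?thesis
    using assms Gamma_real_pos[of x] by simp
next
  case False
  then have "Beta x \<omega> \<le> Beta 1 \<omega>"
    and "Gamma \<omega> > 0" "Gamma (x + \<omega>) > 0" "Gamma (1 + \<omega>) > 0"
    using assms by (auto intro!: Beta_real_mono)
  then show ?thesis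
    by (simp add: Beta_def divide_simps split: if_splits)
qed

text \<open>Each summand is at most a constant times a binomial coefficient, and the binomial row
  sums to \<open>2 ^ k\<close>. The Gamma factor is kept in the bound so that it can be set against
  the one in the denominator of the Bessel series.\<close>

lemma p_Bessel_Phi_bounds:
  assumes "p > 0" and "2 / p \<in> \<nat>"
  shows "0 \<le> p_Bessel_Phi p k \<phi>"
    and "p_Bessel_Phi p k \<phi> \<le> 4 * 2 ^ k * Gamma (2 / p * (real k + 1))"
proof -
  define m where "m = nat \<lfloor>2 / p\<rfloor>"
  obtain j where j: "2 / p = real j"
    using assms by (auto elim: Nats_cases)
  then have m: "2 / p = real m"
    by (simp add: m_def)
  have "m > 0"
    using assms(1) m by (cases m) auto
  define M where "M = Gamma (2 / p * (real k + 1))"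
  have M: "fact (m * (k + 1) - 1) = M"
    using \<open>m > 0\<close> Gamma_fact[of "m * (k + 1) - 1", where 'a = real]
    by (simp add: M_def m of_nat_diff algebra_simps)
  define t where "t n = M / (fact n * fact (k - n))
        * (Beta (2 / p * (real n + 1 / 2)) (2 / p * (real (k - n) + 1 / 2))
           / Beta (real n + 1 / 2) (real (k - n) + 1 / 2))
        * (cos \<phi> ^ (2 * m)) ^ n * (sin \<phi> ^ (2 * m)) ^ (k - n)" for n
  have Phi: "p_Bessel_Phi p k \<phi> = sum t {0..k}"
    unfolding p_Bessel_Phi_def t_def m_def[symmetric] M ..
  have "M > 0"
    unfolding M_def using assms(1) by (intro Gamma_real_pos) auto
  have t: "0 \<le> t n" "t n \<le> 4 * M * real (k choose n)" if "n \<le> k" for n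
  proof -
    define q where "q = Beta (2 / p * (real n + 1 / 2)) (2 / p * (real (k - n) + 1 / 2))"
    define G where "G = Gamma (real n + 1 / 2) * Gamma (real (k - n) + 1 / 2)"
    have q0: "q \<ge> 0"
      unfolding q_def Beta_def using assms(1)
      by (intro divide_nonneg_nonneg mult_nonneg_nonneg less_imp_le[OF Gamma_real_pos])
        (auto intro!: add_pos_pos add_nonneg_pos mult_pos_pos)
    \<comment> \<open>\<open>2 / p\<close> is a positive natural number, hence at least 1. This
      keeps both Beta arguments at \<open>1 / 2\<close> or above.\<close>
    have half: "1 / 2 \<le> 2 / p * (real i + 1 / 2)" for i
    proof -
      have "1 * (1 / 2) \<le> 2 / p * (real i + 1 / 2)"
        using \<open>m > 0\<close> unfolding m by (intro mult_mono) auto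
      then show ?thesis by simp
    qed
    have "q \<le> Beta (1 / 2) (1 / 2)"
      unfolding q_def by (intro Beta_real_mono half) auto
    also have "\<dots> = pi"
      by (simp add: Beta_def Gamma_one_half_real)
    finally have q: "q \<le> pi" .
    have "sqrt pi / 2 * (sqrt pi / 2) \<le> G"
      unfolding G_def by (intro mult_mono Gamma_half_ge) (auto intro: Gamma_real_pos less_imp_le)
    then have G: "pi / 4 \<le> G"
      by simp
    then have "G > 0"
      using pi_gt_zero by linarith
    \<comment> \<open>The two arguments add up to \<open>k + 1\<close>. The resulting
      \<open>fact k\<close> completes \<open>1 / (fact n * fact (k - n))\<close> to a binomial
      coefficient.\<close>
    have B: "Beta (real n + 1 / 2) (real (k - n) + 1 / 2) = G / fact k"
      using that Gamma_fact[of k, where 'a = real]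
      by (simp add: Beta_def G_def of_nat_diff add.commute)
    have c: "0 \<le> (cos \<phi> ^ (2 * m)) ^ n" "0 \<le> (sin \<phi> ^ (2 * m)) ^ (k - n)"
      by (rule zero_le_power[OF zero_le_even_power'])+
    have c1: "(cos \<phi> ^ (2 * m)) ^ n \<le> 1" "(sin \<phi> ^ (2 * m)) ^ (k - n) \<le> 1"
      unfolding power_mult by (simp_all add: power_le_one abs_square_le_1)
    have bin: "real (k choose n) = fact k / (fact n * fact (k - n))"
      using that by (rule binomial_fact)
    have eq: "t n = M * real (k choose n) * (q / G)
        * ((cos \<phi> ^ (2 * m)) ^ n * (sin \<phi> ^ (2 * m)) ^ (k - n))"
      unfolding t_def B q_def[symmetric] bin by simp
    show "0 \<le> t n"
      unfolding eq using \<open>M > 0\<close> q0 \<open>G > 0\<close> c by simp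
    have "q / G \<le> 4"
      using q G \<open>G > 0\<close> by (simp add: divide_simps)
    moreover have "(cos \<phi> ^ (2 * m)) ^ n * (sin \<phi> ^ (2 * m)) ^ (k - n) \<le> 1"
      using c c1 by (intro mult_le_one)
    ultimately have "t n \<le> M * real (k choose n) * 4 * 1"
      unfolding eq using \<open>M > 0\<close> q0 \<open>G > 0\<close> c
      by (intro mult_mono) auto
    then show "t n \<le> 4 * M * real (k choose n)"
      by simp
  qed
  show "0 \<le> p_Bessel_Phi p k \<phi>"
    unfolding Phi by (intro sum_nonneg) (auto intro: t)
  have "sum t {0..k} \<le> (\<Sum>n=0..k. 4 * M * real (k choose n))"
    by (intro sum_mono) (auto intro: t)
  also have "\<dots> = 4 * M * real (\<Sum>n\<le>k. k choose n)"
    by (simp add: sum_distrib_left atMost_atLeast0)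
  also have "\<dots> = 4 * 2 ^ k * M"
    by (simp add: choose_row_sum)
  finally show "p_Bessel_Phi p k \<phi> \<le> 4 * 2 ^ k * Gamma (2 / p * (real k + 1))"
    unfolding Phi M_def .
qed

section \<open>The Bessel function as a power times an entire series\<close>

text \<open>The series is read in the variable \<open>(r / 2)\<^sup>2\<close>, with
  \<open>(r / 2) powr \<omega>\<close> and the constant factor split off, so that the possibly
  non-integer exponent stays outside.\<close>

definition p_Bessel_coeff :: "real \<Rightarrow> real \<Rightarrow> real \<Rightarrow> nat \<Rightarrow> real" where
  "p_Bessel_coeff p \<omega> \<phi> k =
     (-1) ^ k * p_Bessel_Phi p k \<phi> / (fact k * Gamma (2 / p * (real k + 1) + \<omega>))"

text \<open>The Gamma factor in the bound for \<open>p_Bessel_Phi\<close> is absorbed by the one in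
  the denominator, up to the constant \<open>1 / Gamma (1 + \<omega>)\<close>. What remains is the
  exponential series at \<open>2 * \<bar>x\<bar>\<close>.\<close>

lemma summable_p_Bessel_coeff:
  assumes "p > 0" and "2 / p \<in> \<nat>" and "\<omega> \<ge> 0"
  shows "summable (\<lambda>k. \<bar>p_Bessel_coeff p \<omega> \<phi> k * x ^ k\<bar>)"
proof (rule summable_comparison_test')
  show "summable (\<lambda>k. 4 / Gamma (1 + \<omega>) * (inverse (fact k) * (2 * \<bar>x\<bar>) ^ k))"
    by (intro summable_mult summable_exp)
next
  fix k :: nat
  obtain j where j: "2 / p = real j"
    using assms by (auto elim: Nats_cases)
  then have "j > 0"
    using assms(1) by (cases j) auto
  define y where "y = 2 / p * (real k + 1)"
  have "1 * 1 \<le> y"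
    unfolding y_def j using \<open>j > 0\<close> by (intro mult_mono) auto
  then have y: "y \<ge> 1" by simp
  then have pos: "Gamma y > 0" "Gamma (y + \<omega>) > 0" "Gamma (1 + \<omega>) > 0"
    using assms by (auto intro!: Gamma_real_pos)
  have "\<bar>p_Bessel_coeff p \<omega> \<phi> k * x ^ k\<bar>
      = p_Bessel_Phi p k \<phi> / (fact k * Gamma (y + \<omega>)) * \<bar>x\<bar> ^ k"
    using p_Bessel_Phi_bounds(1)[OF assms(1,2), of k \<phi>] pos
    unfolding p_Bessel_coeff_def y_def[symmetric] by (simp add: abs_mult power_abs)
  also have "\<dots> \<le> 4 * 2 ^ k * Gamma y / (fact k * Gamma (y + \<omega>)) * \<bar>x\<bar> ^ k"
    using p_Bessel_Phi_bounds(2)[OF assms(1,2), of k \<phi>] pos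
    unfolding y_def[symmetric] by (intro mult_right_mono divide_right_mono) auto
  also have "\<dots> = 4 * (inverse (fact k) * (2 * \<bar>x\<bar>) ^ k) * (Gamma y / Gamma (y + \<omega>))"
    by (simp add: power_mult_distrib field_simps)
  also have "\<dots> \<le> 4 * (inverse (fact k) * (2 * \<bar>x\<bar>) ^ k) * (1 / Gamma (1 + \<omega>))"
    using y assms(3) by (intro mult_left_mono Gamma_ratio_le) auto
  finally show "norm \<bar>p_Bessel_coeff p \<omega> \<phi> k * x ^ k\<bar>
      \<le> 4 / Gamma (1 + \<omega>) * (inverse (fact k) * (2 * \<bar>x\<bar>) ^ k)"
    by simp
qed

lemma p_Bessel_eq_powser:
  assumes "p > 0" and "2 / p \<in> \<nat>" and "\<omega> \<ge> 0" and "r > 0"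
  shows "p_Bessel p \<omega> \<phi> r = (2 / p) powr (2 + \<omega>) * (pi / (Gamma (1 / p))\<^sup>2) *
    ((r / 2) powr \<omega> * (\<Sum>k. p_Bessel_coeff p \<omega> \<phi> k * ((r / 2)\<^sup>2) ^ k))"
proof -
  have s: "summable (\<lambda>k. p_Bessel_coeff p \<omega> \<phi> k * ((r / 2)\<^sup>2) ^ k)"
    using summable_p_Bessel_coeff[OF assms(1-3)] by (rule summable_rabs_cancel)
  have "(-1) ^ k / (fact k * Gamma (2 / p * (real k + 1) + \<omega>))
           * (if 2 * real k + \<omega> = 0 then 1 else (r / 2) powr (2 * real k + \<omega>))
           * p_Bessel_Phi p k \<phi>
       = (r / 2) powr \<omega> * (p_Bessel_coeff p \<omega> \<phi> k * ((r / 2)\<^sup>2) ^ k)" for k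
  proof -
    \<comment> \<open>For \<open>r > 0\<close> the zeroth power is 1 anyway, so both branches
      agree.\<close>
    have "(if 2 * real k + \<omega> = 0 then 1 else (r / 2) powr (2 * real k + \<omega>))
        = (r / 2) powr (real (2 * k) + \<omega>)"
      using assms(4) by auto
    also have "\<dots> = (r / 2) powr \<omega> * ((r / 2)\<^sup>2) ^ k"
      using assms(4) unfolding powr_add
      by (subst powr_realpow) (auto simp: power_mult)
    finally show ?thesis
      by (simp add: p_Bessel_coeff_def)
  qed
  then show ?thesis
    unfolding p_Bessel_def using suminf_mult[OF s] by simp
qed

section \<open>Termwise differentiation and fractional integration\<close>

text \<open>The Beta integral in the variable \<open>u = t powr p\<close>. It evaluates the
  fractional integral of a single power; both ends of the interval may be singular.\<close>

lemma Beta_kernel_powr: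
  fixes p a b :: real
  assumes "p > 0" and "a > 0" and "b > 0"
  shows "set_integrable lborel {0<..<1} (\<lambda>t. t powr (p * a - 1) * (1 - t powr p) powr (b - 1))"
    (is "set_integrable _ _ ?f")
    and "(LBINT t:{0<..<1}. t powr (p * a - 1) * (1 - t powr p) powr (b - 1)) = Beta a b / p"
proof -
  define g where "g u = u powr (1 / p)" for u :: real
  define g' where "g' u = 1 / p * u powr (1 / p - 1)" for u :: real
  \<comment> \<open>The exponent of \<open>u\<close> is
    \<open>(p * a - 1) / p + (1 / p - 1) = a - 1\<close>.\<close>
  have fg: "?f (g u) * g' u = 1 / p * (u powr (a - 1) * (1 - u) powr (b - 1))"
    if "u \<in> {0<..<1}" for u
    using that assms(1)
    by (simp add: g_def g'_def powr_powr powr_add[symmetric] algebra_simps diff_divide_distrib)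
  have Beta_int: "set_integrable lborel {0<..<1} (\<lambda>u. u powr (a - 1) * (1 - u) powr (b - 1))"
    using integrable_Beta[OF assms(2,3)] by (rule set_integrable_subset) auto
  have Beta: "(LBINT u:{0<..<1}. u powr (a - 1) * (1 - u) powr (b - 1)) = Beta a b"
    using set_borel_integral_eq_integral(2)[OF Beta_int] has_integral_Beta_real[OF assms(2,3)]
    by (simp add: has_integral_Icc_iff_Ioo integral_unique)
  have int: "set_integrable lborel (einterval 0 1) (\<lambda>u. ?f (g u) * g' u)"
  proof -
    have "set_integrable lborel {0<..<1} (\<lambda>u. 1 / p * (u powr (a - 1) * (1 - u) powr (b - 1)))"
      using Beta_int by (rule set_integrable_mult_right)
    then show ?thesis
      unfolding zero_ereal_def one_ereal_def einterval_eq_Icc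
      by (subst set_integrable_cong[OF refl refl fg]) (auto simp: zero_ereal_def one_ereal_def)
  qed
  have rng: "0 < g u" "g u < 1" if "0 < u" "u < 1" for u
    using that assms(1) powr_less_mono2[of "1 / p" u 1] by (auto simp: g_def)
  \<comment> \<open>As the kernel may blow up at 0 and 1, the substitution is made on the open
    interval, where only the limits of \<open>g\<close> at the ends are required.\<close>
  have "(g \<longlongrightarrow> g 0) (at_right 0)"
    unfolding g_def using assms(1)
    by (auto intro!: tendsto_eq_intros eventually_at_rightI[of 0 1])
  then have A: "((ereal \<circ> g \<circ> real_of_ereal) \<longlongrightarrow> 0) (at_right 0)"
    unfolding zero_ereal_def ereal_tendsto_simps1
    by (simp add: g_def[abs_def] o_def)
  have "(g \<longlongrightarrow> g 1) (at_left 1)"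
    unfolding g_def by (auto intro!: tendsto_eq_intros)
  then have B: "((ereal \<circ> g \<circ> real_of_ereal) \<longlongrightarrow> 1) (at_left 1)"
    unfolding one_ereal_def ereal_tendsto_simps1
    by (simp add: g_def[abs_def] o_def)
  \<comment> \<open>For a nonnegative integrand, integrability after the substitution also yields
    integrability before it.\<close>
  note subst = interval_integral_substitution_nonneg[where f = ?f and g = g and g' = g',
      OF _ _ _ _ _ _ A B int]
  have cond: "(g has_real_derivative g' u) (at u)" "isCont ?f (g u)" "isCont g' u" "0 \<le> ?f (g u)"
    if "0 < ereal u" "ereal u < 1" for u
  proof -
    have u: "0 < u" "u < 1"
      using that by (auto simp: zero_ereal_def one_ereal_def)
    then show "(g has_real_derivative g' u) (at u)" "isCont g' u" "0 \<le> ?f (g u)"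
      using assms(1) unfolding g_def g'_def by (auto intro!: derivative_eq_intros continuous_intros)
    show "isCont ?f (g u)"
      using rng[OF u] assms(1) by (auto intro!: continuous_intros simp: powr_eq_one_iff_gen)
  qed
  have g'0: "0 \<le> g' u" for u
    using assms(1) by (simp add: g'_def)
  show "set_integrable lborel {0<..<1} ?f"
    using subst(1)[OF _ cond g'0] by (simp add: zero_ereal_def one_ereal_def)
  have "(LBINT t:{0<..<1}. ?f t) = (LBINT u:{0<..<1}. ?f (g u) * g' u)"
    using subst(2)[OF _ cond g'0]
    by (simp add: zero_ereal_def one_ereal_def interval_lebesgue_integral_def)
  also have "\<dots> = (LBINT u:{0<..<1}. 1 / p * (u powr (a - 1) * (1 - u) powr (b - 1)))"
    by (intro set_lebesgue_integral_cong allI impI fg; simp)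
  also have "\<dots> = Beta a b / p"
    unfolding set_integral_mult_right Beta by simp
  finally show "(LBINT t:{0<..<1}. ?f t) = Beta a b / p" .
qed

text \<open>The operator \<open>s * d/ds\<close> multiplies \<open>s powr (\<mu> + 2 * k)\<close> by
  \<open>\<mu> + 2 * k\<close>. For the series this is the product rule, with
  \<open>2 * y * F'\<close> at \<open>y = (s / 2)\<^sup>2\<close> supplying the part
  \<open>2 * k\<close>.\<close>

lemma has_field_derivative_powr_powser:
  fixes c :: "nat \<Rightarrow> real"
  assumes c: "\<And>x. summable (\<lambda>k. c k * x ^ k)" and "s > 0"
  shows "((\<lambda>s. s powr \<mu> * (\<Sum>k. c k * ((s / 2)\<^sup>2) ^ k)) has_field_derivative
      s powr (\<mu> - 1) * (\<Sum>k. (\<mu> + 2 * real k) * c k * ((s / 2)\<^sup>2) ^ k)) (at s)"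
proof -
  define y where "y = (s / 2)\<^sup>2"
  define F where "F x = (\<Sum>k. c k * x ^ k)" for x
  define F' where "F' = (\<Sum>k. diffs c k * y ^ k)"
  have F: "(F has_field_derivative F') (at y)"
    unfolding F_def F'_def by (rule termdiffs_strong_converges_everywhere[OF c])
  have "(\<lambda>k. of_nat k * c k * y ^ (k - Suc 0)) sums F'"
    unfolding F'_def by (intro diffs_equiv termdiff_converges_all c)
  then have "(\<lambda>k. 2 * y * (of_nat k * c k * y ^ (k - Suc 0))) sums (2 * y * F')"
    by (rule sums_mult)
  \<comment> \<open>At \<open>k = 0\<close> the truncated exponent is harmless because the factor
    \<open>k\<close> vanishes.\<close>
  moreover have "2 * y * (of_nat k * c k * y ^ (k - Suc 0)) = 2 * real k * c k * y ^ k" for k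
    by (cases k) auto
  ultimately have yF': "(\<lambda>k. 2 * real k * c k * y ^ k) sums (2 * y * F')"
    by simp
  have "(\<lambda>k. \<mu> * (c k * y ^ k)) sums (\<mu> * F y)"
    unfolding F_def using c by (intro sums_mult summable_sums)
  from sums_add[OF this yF']
  have sum: "(\<Sum>k. (\<mu> + 2 * real k) * c k * y ^ k) = \<mu> * F y + 2 * y * F'"
    by (intro sums_unique[symmetric]) (simp add: algebra_simps)
  have "((\<lambda>s. (s / 2)\<^sup>2) has_field_derivative s / 2) (at s)"
    by (auto intro!: derivative_eq_intros)
  from DERIV_chain2[OF F[unfolded y_def] this]
  have "((\<lambda>s. F ((s / 2)\<^sup>2)) has_field_derivative F' * (s / 2)) (at s)" .
  from DERIV_mult'[OF has_real_derivative_powr[OF assms(2), of \<mu>] this]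
  have "((\<lambda>s. s powr \<mu> * F ((s / 2)\<^sup>2)) has_field_derivative
      s powr \<mu> * (F' * (s / 2)) + \<mu> * s powr (\<mu> - 1) * F y) (at s)"
    unfolding y_def .
  moreover have "s powr \<mu> * (F' * (s / 2)) + \<mu> * s powr (\<mu> - 1) * F y
      = s powr (\<mu> - 1) * (\<mu> * F y + 2 * y * F')"
  proof -
    have "s powr \<mu> = s powr (\<mu> - 1) * s"
      using assms(2) by (simp add: powr_diff)
    then show ?thesis
      by (simp add: y_def power2_eq_square algebra_simps)
  qed
  ultimately show ?thesis
    unfolding y_def[symmetric] sum by (simp add: F_def)
qed

text \<open>The \<open>k\<close>-th term contributes the kernel \<open>t powr (p * a k - 1)\<close>,
  hence \<open>Beta (a k) \<gamma> / p\<close>; the prefactor \<open>p / Gamma \<gamma>\<close>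
  reduces this to the quotient of Gamma values. Absolute convergence permits summing under the
  integral.\<close>

lemma EK_integral_powr_powser:
  fixes c :: "nat \<Rightarrow> real" and p \<eta> \<gamma> \<beta> s :: real and f :: "real \<Rightarrow> real"
  defines "a \<equiv> \<lambda>k. \<eta> + 1 + (\<beta> + 2 * real k) / p"
  assumes "p > 0" and "\<gamma> > 0" and a0: "a 0 > 0"
    and c: "\<And>x. summable (\<lambda>k. \<bar>c k * x ^ k\<bar>)"
    and f: "\<And>t. t > 0 \<Longrightarrow> f t = (t / 2) powr \<beta> * (\<Sum>k. c k * ((t / 2)\<^sup>2) ^ k)"
    and "s > 0"
  shows "set_integrable lborel {0<..<1} (EK_integrand p \<eta> \<gamma> f s)"
    and "EK_integral p \<eta> \<gamma> f s
      = (s / 2) powr \<beta> * (\<Sum>k. c k * Gamma (a k) / Gamma (a k + \<gamma>) * ((s / 2)\<^sup>2) ^ k)"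
proof -
  define y where "y = (s / 2)\<^sup>2"
  define C where "C k = (s / 2) powr \<beta> * (c k * y ^ k)" for k
  define K where "K k t = t powr (p * a k - 1) * (1 - t powr p) powr (\<gamma> - 1)" for k t
  \<comment> \<open>The terms are extended by zero to the whole line, so that series and integral
    are exchanged over \<open>lborel\<close>.\<close>
  define h where "h k t = indicator {0<..<1} t * (C k * K k t)" for k t
  have "a 0 \<le> a k" for k
    unfolding a_def using \<open>p > 0\<close> by (auto intro: divide_right_mono)
  then have a: "a k > 0" for k
    using a0 less_le_trans by blast
  have K: "set_integrable lborel {0<..<1} (K k)"
      "(LBINT t:{0<..<1}. K k t) = Beta (a k) \<gamma> / p" for k
    unfolding K_def using Beta_kernel_powr[OF \<open>p > 0\<close> a \<open>\<gamma> > 0\<close>] by auto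
  have h_int: "integrable lborel (h k)" for k
    using set_integrable_mult_right[OF K(1), of "C k"]
    by (simp add: set_integrable_def h_def[abs_def])
  have LBINT_CK: "(LBINT t:{0<..<1}. D * K k t) = D * (Beta (a k) \<gamma> / p)" for k D
    using K(2)[of k] by simp
  have h_eq: "integral\<^sup>L lborel (h k) = C k * (Beta (a k) \<gamma> / p)" for k
    using LBINT_CK[of "C k" k] by (simp only: set_lebesgue_integral_def h_def[abs_def] real_scaleR_def)
  have norm_h: "norm (h k t) = indicator {0<..<1} t * (\<bar>C k\<bar> * K k t)" for k t
    by (simp add: h_def K_def abs_mult)
  have h_norm: "(\<integral>t. norm (h k t) \<partial>lborel) = \<bar>C k\<bar> * (Beta (a k) \<gamma> / p)" for k
    using LBINT_CK[of "\<bar>C k\<bar>" k] by (simp only: set_lebesgue_integral_def norm_h real_scaleR_def)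
  have C_abs: "summable (\<lambda>k. \<bar>C k\<bar>)"
    using summable_mult[OF c[of y], of "(s / 2) powr \<beta>"] by (simp add: C_def abs_mult)
  have sum_norm: "summable (\<lambda>k. \<integral>t. norm (h k t) \<partial>lborel)"
  proof (rule summable_comparison_test')
    \<comment> \<open>Since \<open>a k\<close> is smallest at \<open>k = 0\<close> and Beta is
      decreasing, \<open>Beta (a 0) \<gamma>\<close> bounds all the Beta factors.\<close>
    show "summable (\<lambda>k. \<bar>C k\<bar> * (Beta (a 0) \<gamma> / p))"
      using C_abs by (rule summable_mult2)
    show "norm (\<integral>t. norm (h k t) \<partial>lborel) \<le> \<bar>C k\<bar> * (Beta (a 0) \<gamma> / p)" for k
    proof -
      have "norm (\<integral>t. norm (h k t) \<partial>lborel) = (\<integral>t. norm (h k t) \<partial>lborel)"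
        by simp
      also have "\<dots> \<le> \<bar>C k\<bar> * (Beta (a 0) \<gamma> / p)"
        unfolding h_norm using \<open>a 0 \<le> a k\<close> a0 \<open>\<gamma> > 0\<close> \<open>p > 0\<close>
        by (intro mult_left_mono divide_right_mono Beta_real_mono) auto
      finally show ?thesis .
    qed
  qed
  have integrand: "indicator {0<..<1} t * EK_integrand p \<eta> \<gamma> f s t = (\<Sum>k. h k t)"
    and h_summable: "summable (\<lambda>k. norm (h k t))" for t
  proof -
    show "summable (\<lambda>k. norm (h k t))"
      and "indicator {0<..<1} t * EK_integrand p \<eta> \<gamma> f s t = (\<Sum>k. h k t)"
    proof (atomize (full), cases "t \<in> {0<..<1}")
      case True
      then have t: "0 < t" "t < 1" by auto
      define x where "x = (t * s / 2)\<^sup>2"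
      \<comment> \<open>\<open>E\<close> collects the factors of the integrand that do not depend on
        \<open>k\<close>.\<close>
      define E where "E = t powr (p * (\<eta> + 1) - 1) * (t * s / 2) powr \<beta> * (1 - t powr p) powr (\<gamma> - 1)"
      have hk: "h k t = E * (c k * x ^ k)" for k
      proof -
        have "p * a k - 1 = (p * (\<eta> + 1) - 1) + \<beta> + real (2 * k)"
          using \<open>p > 0\<close> by (simp add: a_def field_simps)
        then have "t powr (p * a k - 1) = t powr (p * (\<eta> + 1) - 1) * t powr \<beta> * t powr real (2 * k)"
          by (simp only: powr_add)
        also have "t powr real (2 * k) = (t\<^sup>2) ^ k"
          unfolding powr_realpow[OF t(1)] power_mult ..
        finally have "t powr (p * a k - 1) = t powr (p * (\<eta> + 1) - 1) * t powr \<beta> * (t\<^sup>2) ^ k" .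
        then show ?thesis
          using t \<open>s > 0\<close> True
          by (simp add: h_def C_def K_def E_def x_def y_def powr_mult powr_divide power_mult_distrib
              power_divide field_simps)
      qed
      have "summable (\<lambda>k. norm (h k t))"
        using summable_mult[OF c[of x], of "\<bar>E\<bar>"] by (simp add: hk abs_mult)
      moreover have "(\<Sum>k. h k t) = E * (\<Sum>k. c k * x ^ k)"
        unfolding hk by (intro suminf_mult summable_rabs_cancel[OF c])
      moreover have "EK_integrand p \<eta> \<gamma> f s t = E * (\<Sum>k. c k * x ^ k)"
      proof -
        have "(1 - t powr p) powr (\<gamma> - 1) = 1 / (1 - t powr p) powr (1 - \<gamma>)"
          by (simp add: powr_minus_divide[symmetric])
        then show ?thesis
          using t \<open>s > 0\<close> by (simp add: EK_integrand_def f E_def x_def)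
      qed
      ultimately show "summable (\<lambda>k. norm (h k t)) \<and>
          indicator {0<..<1} t * EK_integrand p \<eta> \<gamma> f s t = (\<Sum>k. h k t)"
        using True by simp
    qed (simp add: h_def)
  qed
  note suminf_thms = h_int AE_I2[of lborel, OF h_summable] sum_norm
  show "set_integrable lborel {0<..<1} (EK_integrand p \<eta> \<gamma> f s)"
    using integrable_suminf[OF suminf_thms] by (simp add: set_integrable_def integrand)
  have sums: "(\<lambda>k. C k * (Beta (a k) \<gamma> / p)) sums (LBINT t:{0<..<1}. EK_integrand p \<eta> \<gamma> f s t)"
    using sums_integral[OF suminf_thms]
    by (simp add: set_lebesgue_integral_def integrand h_eq)
  have "Gamma \<gamma> > 0"
    using \<open>\<gamma> > 0\<close> by simp
  then have "p / Gamma \<gamma> * (C k * (Beta (a k) \<gamma> / p))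
      = (s / 2) powr \<beta> * (c k * Gamma (a k) / Gamma (a k + \<gamma>) * y ^ k)" for k
    using \<open>p > 0\<close> by (simp add: Beta_def C_def)
  with sums_mult[OF sums, of "p / Gamma \<gamma>"]
  have "(\<lambda>k. (s / 2) powr \<beta> * (c k * Gamma (a k) / Gamma (a k + \<gamma>) * y ^ k))
      sums EK_integral p \<eta> \<gamma> f s"
    by (simp add: EK_integral_def)
  \<comment> \<open>Dividing by the nonzero power yields convergence of the new series together with
    its value.\<close>
  from sums_divide[OF this, of "(s / 2) powr \<beta>"] have "(\<lambda>k. c k * Gamma (a k) / Gamma (a k + \<gamma>) * y ^ k)
      sums (EK_integral p \<eta> \<gamma> f s / (s / 2) powr \<beta>)"
    using \<open>s > 0\<close> by simp
  from sums_unique[OF this] show "EK_integral p \<eta> \<gamma> f s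
      = (s / 2) powr \<beta> * (\<Sum>k. c k * Gamma (a k) / Gamma (a k + \<gamma>) * ((s / 2)\<^sup>2) ^ k)"
    using \<open>s > 0\<close> by (simp add: y_def field_simps)
qed

section \<open>The fractional derivative of the p-Bessel function\<close>

theorem theorem1p2:
  fixes p \<phi> \<omega> \<gamma> \<eta> :: real
  assumes "p > 0" and "2 / p \<in> \<nat>"
    and "0 \<le> \<phi>" and "\<phi> < 2 * pi"
    and "\<omega> \<ge> 0"
    and "0 < \<gamma>" and "\<gamma> < 1"
    and "\<eta> = (1 - 1 / p) * \<omega> + (2 - \<gamma>) / p - 1"
  shows "\<forall>r>0.
      EK_deriv_exists p \<eta> \<gamma> (p_Bessel p (\<omega> + \<gamma>) \<phi>) r \<and>
      EK_deriv p \<eta> \<gamma> (p_Bessel p (\<omega> + \<gamma>) \<phi>) r = (r / p) powr \<gamma> * p_Bessel p \<omega> \<phi> r"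
proof (intro allI impI)
  fix r :: real
  assume r: "r > 0"
  let ?J = "p_Bessel p (\<omega> + \<gamma>) \<phi>"
  define L where "L = pi / (Gamma (1 / p))\<^sup>2"
  define N where "N = (2 / p) powr (2 + (\<omega> + \<gamma>)) * L"
  define A where "A k = 2 / p * (real k + 1) + \<omega>" for k
  define c where "c k = N * p_Bessel_coeff p (\<omega> + \<gamma>) \<phi> k" for k
  \<comment> \<open>The fractional integral raises the order from \<open>\<omega> + \<gamma>\<close>
    to \<open>\<omega> + 1\<close>, while the constant \<open>N\<close> of the original order
    stays.\<close>
  define d where "d k = N * p_Bessel_coeff p (\<omega> + 1) \<phi> k" for k
  \<comment> \<open>\<open>\<mu>\<close> is the total exponent of \<open>s\<close> outside the
    series once \<open>s powr (p * (1 + \<eta>))\<close> meets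
    \<open>s powr (\<omega> + \<gamma>)\<close>; it satisfies
    \<open>\<mu> + 2 * k = p * A k\<close>.\<close>
  define \<mu> where "\<mu> = 2 + p * \<omega>"
  have A: "A k > 0" for k
  proof -
    have "2 / p * (real k + 1) > 0"
      using assms(1) by (intro mult_pos_pos) auto
    then show ?thesis
      unfolding A_def using assms(5) by linarith
  qed
  have a: "\<eta> + \<gamma> + 1 + (\<omega> + \<gamma> + 2 * real k) / p = A k + \<gamma>" for k
    using assms(1) by (simp add: assms(8) A_def field_simps)
  have p\<eta>: "p * (1 + \<eta>) = \<mu> - (\<omega> + \<gamma>)"
    using assms(1) by (simp add: assms(8) \<mu>_def field_simps)
  have c: "summable (\<lambda>k. \<bar>c k * x ^ k\<bar>)" for x
    using summable_mult[OF summable_p_Bessel_coeff[OF assms(1,2), of "\<omega> + \<gamma>" \<phi> x], of "\<bar>N\<bar>"] assms(5,6)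
    by (simp add: c_def abs_mult mult.assoc)
  have d: "summable (\<lambda>k. d k * x ^ k)" for x
    using summable_mult[OF summable_rabs_cancel[OF summable_p_Bessel_coeff[OF assms(1,2), of "\<omega> + 1" \<phi> x]], of N]
      assms(5)
    by (simp add: d_def mult.assoc)
  have J: "?J t = (t / 2) powr (\<omega> + \<gamma>) * (\<Sum>k. c k * ((t / 2)\<^sup>2) ^ k)" if "t > 0" for t
  proof -
    have "summable (\<lambda>k. p_Bessel_coeff p (\<omega> + \<gamma>) \<phi> k * ((t / 2)\<^sup>2) ^ k)"
      using assms by (intro summable_rabs_cancel[OF summable_p_Bessel_coeff]) auto
    from suminf_mult[OF this, of N] show ?thesis
      using p_Bessel_eq_powser[OF assms(1,2) _ that, of "\<omega> + \<gamma>" \<phi>] assms(5,6)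
      by (simp add: c_def N_def L_def mult_ac)
  qed
  have cd: "c k * Gamma (A k + \<gamma>) / Gamma (A k + \<gamma> + (1 - \<gamma>)) = d k" for k
  proof -
    have "Gamma (A k + \<gamma>) > 0"
      using A[of k] assms by simp
    then show ?thesis
      unfolding c_def d_def p_Bessel_coeff_def add.assoc[symmetric] A_def[symmetric]
      by simp
  qed
  have EK: "set_integrable lborel {0<..<1} (EK_integrand p (\<eta> + \<gamma>) (1 - \<gamma>) ?J s)"
    "EK_integral p (\<eta> + \<gamma>) (1 - \<gamma>) ?J s
      = (s / 2) powr (\<omega> + \<gamma>) * (\<Sum>k. d k * ((s / 2)\<^sup>2) ^ k)" if "s > 0" for s
    using A[of 0] EK_integral_powr_powser[where \<beta> = "\<omega> + \<gamma>" and \<eta> = "\<eta> + \<gamma>" and \<gamma> = "1 - \<gamma>" and f = ?J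
        and p = p and c = c and s = s, unfolded a cd, OF assms(1) _ _ c J that] assms(6,7)
    by simp_all
  define H where "H s = s powr (p * (1 + \<eta>)) * EK_integral p (\<eta> + \<gamma>) (1 - \<gamma>) ?J s" for s
  define S where "S = (\<Sum>k. p_Bessel_coeff p \<omega> \<phi> k * ((r / 2)\<^sup>2) ^ k)"
  have H: "H s = (1 / 2) powr (\<omega> + \<gamma>) * (s powr \<mu> * (\<Sum>k. d k * ((s / 2)\<^sup>2) ^ k))" if "s > 0" for s
    using that unfolding H_def EK(2)[OF that] p\<eta>
    by (simp add: powr_divide powr_diff)
  have S: "(\<Sum>k. (\<mu> + 2 * real k) * d k * ((r / 2)\<^sup>2) ^ k) = p * N * S"
  proof -
    have "(\<mu> + 2 * real k) * d k = p * N * p_Bessel_coeff p \<omega> \<phi> k" for k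
    proof -
      have "\<mu> + 2 * real k = p * A k"
        using assms(1) by (simp add: \<mu>_def A_def field_simps)
      moreover have "Gamma (A k + 1) = A k * Gamma (A k)"
        using A[of k] by (intro Gamma_plus1) (auto elim!: nonpos_Ints_cases)
      ultimately show ?thesis
        using A[of k] unfolding d_def p_Bessel_coeff_def add.assoc[symmetric] A_def[symmetric]
        by simp
    qed
    moreover have "summable (\<lambda>k. p_Bessel_coeff p \<omega> \<phi> k * ((r / 2)\<^sup>2) ^ k)"
      using assms by (intro summable_rabs_cancel[OF summable_p_Bessel_coeff]) auto
    ultimately show ?thesis
      using suminf_mult[of "\<lambda>k. p_Bessel_coeff p \<omega> \<phi> k * ((r / 2)\<^sup>2) ^ k" "p * N"]
      by (simp add: S_def mult.assoc)
  qed
  have "((\<lambda>s. (1 / 2) powr (\<omega> + \<gamma>) * (s powr \<mu> * (\<Sum>k. d k * ((s / 2)\<^sup>2) ^ k)))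
      has_field_derivative (1 / 2) powr (\<omega> + \<gamma>) * (r powr (\<mu> - 1) * (p * N * S))) (at r)"
    using DERIV_cmult[OF has_field_derivative_powr_powser[OF d r, of \<mu>]] unfolding S .
  \<comment> \<open>The series formula for \<open>H\<close> is available for positive arguments, so
    the derivative is transferred on the open half-line containing \<open>r\<close>.\<close>
  then have H': "(H has_field_derivative (1 / 2) powr (\<omega> + \<gamma>) * (r powr (\<mu> - 1) * (p * N * S))) (at r)"
    by (rule has_field_derivative_transform_within_open[where S = "{0<..}"]) (use r H in auto)
  have "EK_deriv p \<eta> \<gamma> ?J r = r powr (- p * \<eta>) * (1 / (p * r powr (p - 1)) *
      ((1 / 2) powr (\<omega> + \<gamma>) * (r powr (\<mu> - 1) * (p * N * S))))"
    unfolding EK_deriv_def H_def[symmetric] DERIV_imp_deriv[OF H'] ..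
  also have "\<dots> = (1 / 2) powr (\<omega> + \<gamma>) * r powr (- p * \<eta> - (p - 1) + (\<mu> - 1)) * N * S"
    unfolding powr_add powr_diff[of r "- p * \<eta>"] using assms(1) r by simp
  also have "- p * \<eta> - (p - 1) + (\<mu> - 1) = \<omega> + \<gamma>"
    using p\<eta> by (simp add: algebra_simps)
  \<comment> \<open>The surplus \<open>(2 / p) powr \<gamma>\<close> in \<open>N\<close> combines
    with \<open>(r / 2) powr \<gamma>\<close> to \<open>(r / p) powr \<gamma>\<close>.\<close>
  also have "(1 / 2) powr (\<omega> + \<gamma>) * r powr (\<omega> + \<gamma>) * N * S
      = (r / p) powr \<gamma> * ((2 / p) powr (2 + \<omega>) * L * ((r / 2) powr \<omega> * S))"
    unfolding N_def using assms(1) r by (simp add: powr_add powr_divide field_simps)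
  also have "\<dots> = (r / p) powr \<gamma> * p_Bessel p \<omega> \<phi> r"
    using p_Bessel_eq_powser[OF assms(1,2,5) r, of \<phi>] by (simp add: S_def L_def)
  finally have "EK_deriv p \<eta> \<gamma> ?J r = (r / p) powr \<gamma> * p_Bessel p \<omega> \<phi> r" .
  moreover have "EK_deriv_exists p \<eta> \<gamma> ?J r"
    unfolding EK_deriv_exists_def H_def[symmetric] using EK(1) H'
    by (auto simp: field_differentiable_def)
  ultimately show "EK_deriv_exists p \<eta> \<gamma> ?J r \<and>
      EK_deriv p \<eta> \<gamma> ?J r = (r / p) powr \<gamma> * p_Bessel p \<omega> \<phi> r" by blast
qed

end
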